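(* Let $-\infty<a<b<\infty$. For weights $\gamma\in L^\infty_+([a,b])$ and admissible exponents $p$ on $[a,b]$, both unknown, the DN map $m\mapsto\Lambda_\gamma^p(m)$, $m>0$, determines, in a constructive way, the quantities $p^+$ and $p^-$ and, if these are reached in sets of positive measure, also the integrals $$\int_{\{x\in[a,b]:\,p(x)=p^-\}}\gamma(x)^{-1/(p^--1)}\,dx\quad\text{and}\quad \int_{\{x\in[a,b]:\,p(x)=p^+\}}\gamma(x)^{-1/(p^+-1)}\,dx .$$ That is: let $\gamma_1,\gamma_2\in L^\infty_+([a,b])$ and let $p_1,p_2$ be admissible exponents with $\Lambda_{\gamma_1}^{p_1}(m)=\Lambda_{\gamma_2}^{p_2}(m)$ for all $m>0$. Then $p_1^+=p_2^+$ and $p_1^-=p_2^-$. Moreover, for each choice of sign $\pm$, if both sets $\{x\in[a,b]:p_i(x)=p_i^\pm\}$, $i=1,2$, have positive Lebesgue measure, then $$\int_{\{x\in[a,b]:\,p_1(x)=p_1^\pm\}}\gamma_1(x)^{-1/(p_1^\pm-1)}\,dx=\int_{\{x\in[a,b]:\,p_2(x)=p_2^\pm\}}\gamma_2(x)^{-1/(p_2^\pm-1)}\,dx .$$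
   Context: $\gamma\in L^\infty_+([a,b])$ means that $\gamma$ is Lebesgue measurable and there is $\varepsilon>0$ with $\varepsilon<\gamma(x)<1/\varepsilon$ for a.e. $x\in[a,b]$. An exponent $p$ is called admissible if it is Lebesgue measurable on $[a,b]$ and there is $\varepsilon>0$ with $1+\varepsilon<p(x)<1/\varepsilon$ for a.e. $x\in[a,b]$. Write $p^-=\operatorname{ess\,inf}_{a\le x\le b}p(x)$ and $p^+=\operatorname{ess\,sup}_{a\le x\le b}p(x)$. For $m>0$ let $K_m=K_m(\gamma,p)>0$ be the unique positive number satisfying $$m=\int_a^b \gamma(x)^{-1/(p(x)-1)}K_m^{1/(p(x)-1)}\,dx .$$ (The map $m\mapsto K_m$ is a well-defined, strictly increasing continuous bijection of $(0,\infty)$ onto itself with continuous inverse.) The Dirichlet-to-Neumann (DN) map is the function $$\Lambda_\gamma^p(m)=\int_a^b\gamma(x)^{-1/(p(x)-1)}K_m^{p(x)/(p(x)-1)}\,dx=mK_m,\qquad m>0 .$$ *)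

theory Defs
  imports "HOL-Analysis.Analysis" "HOL-Probability.Essential_Supremum"
begin

text \<open>Functions on the interval from \<open>a\<close> to \<open>b\<close> are total functions \<open>real \<Rightarrow> real\<close>;
  only their values on \<open>{a..b}\<close> enter below, since every notion is relative to
  \<open>lebesgue_on {a..b}\<close>.\<close>

definition Linf_plus :: "real \<Rightarrow> real \<Rightarrow> (real \<Rightarrow> real) \<Rightarrow> bool" where
  "Linf_plus a b \<gamma> \<longleftrightarrow>
     \<gamma> \<in> borel_measurable (lebesgue_on {a..b}) \<and>
     (\<exists>\<epsilon>>0. AE x in lebesgue_on {a..b}. \<epsilon> < \<gamma> x \<and> \<gamma> x < 1 / \<epsilon>)"

definition admissible :: "real \<Rightarrow> real \<Rightarrow> (real \<Rightarrow> real) \<Rightarrow> bool" where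
  "admissible a b p \<longleftrightarrow>
     p \<in> borel_measurable (lebesgue_on {a..b}) \<and>
     (\<exists>\<epsilon>>0. AE x in lebesgue_on {a..b}. 1 + \<epsilon> < p x \<and> p x < 1 / \<epsilon>)"

text \<open>The library has \<^const>\<open>esssup\<close> but no dual. Both are taken in \<^typ>\<open>ereal\<close>, because
  \<^const>\<open>esssup\<close> needs a complete linear order, and converted back to \<^typ>\<open>real\<close>; for
  admissible exponents and \<open>a < b\<close> both values are finite.\<close>

definition essinf :: "'a measure \<Rightarrow> ('a \<Rightarrow> ereal) \<Rightarrow> ereal" where
  "essinf M f = Sup {z. AE x in M. z \<le> f x}"

definition p_plus :: "real \<Rightarrow> real \<Rightarrow> (real \<Rightarrow> real) \<Rightarrow> real" where
  "p_plus a b p = real_of_ereal (esssup (lebesgue_on {a..b}) (\<lambda>x. ereal (p x)))"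

definition p_minus :: "real \<Rightarrow> real \<Rightarrow> (real \<Rightarrow> real) \<Rightarrow> real" where
  "p_minus a b p = real_of_ereal (essinf (lebesgue_on {a..b}) (\<lambda>x. ereal (p x)))"

text \<open>The Bochner integral of a non-integrable function is \<open>0\<close>, so for \<open>m > 0\<close> the defining
  equation of \<open>K_const\<close> can only hold with a genuinely convergent integral.\<close>

definition K_const :: "real \<Rightarrow> real \<Rightarrow> (real \<Rightarrow> real) \<Rightarrow> (real \<Rightarrow> real) \<Rightarrow> real \<Rightarrow> real" where
  "K_const a b \<gamma> p m =
     (THE K. K > 0 \<and>
        m = (LINT x|lebesgue_on {a..b}. \<gamma> x powr (- 1 / (p x - 1)) * K powr (1 / (p x - 1))))"

definition DN_map :: "real \<Rightarrow> real \<Rightarrow> (real \<Rightarrow> real) \<Rightarrow> (real \<Rightarrow> real) \<Rightarrow> real \<Rightarrow> real" where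
  "DN_map a b \<gamma> p m =
     (LINT x|lebesgue_on {a..b}.
        \<gamma> x powr (- 1 / (p x - 1)) * K_const a b \<gamma> p m powr (p x / (p x - 1)))"

end

theory Submission
  imports Defs
begin

text \<open>
  Put \<open>s = 1 / (p - 1)\<close> and \<open>w = \<gamma> powr (- s)\<close>, and let \<open>F K\<close> be the integral of
  \<open>w * K powr s\<close>.  Since \<open>s\<close> is bounded and bounded away from \<open>0\<close>, the function \<open>F\<close> is a
  continuous strictly increasing bijection of the positive reals, and \<open>K_const\<close> is its inverse.
  Hence the DN map takes the value \<open>K * F K\<close> at \<open>F K\<close> (\<open>DN_map_at_F\<close>), so that it
  determines \<open>F\<close> on the positive reals: equal DN maps give equal functions \<open>F\<close>.

  It remains to read off \<open>s\<close> and \<open>w\<close> from \<open>F\<close>.  As \<open>K\<close> tends to infinity, \<open>F K\<close> grows faster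
  than \<open>K powr c\<close> for each \<open>c\<close> below the essential supremum \<open>S\<close> of \<open>s\<close>, and
  \<open>K powr (- S) * F K\<close> converges, by dominated convergence, to the integral of \<open>w\<close> over the set
  where \<open>s = S\<close> (\<open>powr_integral_determines_ess_max\<close>).  As \<open>s\<close> is a decreasing function of \<open>p\<close>,
  \<open>S = 1 / (p\<^sup>- - 1)\<close>, and the set is the one where \<open>p = p\<^sup>-\<close>.  The same lemma for \<open>- s\<close>, that is,
  for \<open>F (1 / K)\<close>, gives \<open>p\<^sup>+\<close> and the integral over the set where \<open>p = p\<^sup>+\<close>.
\<close>

section \<open>Growth of integrals of powers\<close>

text \<open>\<open>S\<close> is the least real essential upper bound of \<open>f\<close>.  A predicate is used instead of
  \<^const>\<open>esssup\<close> in order to remain in the real numbers and to treat lower bounds by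
  negating \<open>f\<close>.\<close>

definition ess_max :: "'a measure \<Rightarrow> ('a \<Rightarrow> real) \<Rightarrow> real \<Rightarrow> bool" where
  "ess_max M f S \<longleftrightarrow> (AE x in M. f x \<le> S) \<and> (\<forall>c. (AE x in M. f x \<le> c) \<longrightarrow> S \<le> c)"

lemma integrable_powr_upper:
  fixes w s :: "'a \<Rightarrow> real"
  assumes w: "integrable M w" and [measurable]: "s \<in> borel_measurable M"
    and s: "AE x in M. s x \<le> S" and K: "1 \<le> K"
  shows "integrable M (\<lambda>x. w x * K powr s x)"
proof (rule Bochner_Integration.integrable_bound)
  have [measurable]: "w \<in> borel_measurable M" using w by auto
  show "integrable M (\<lambda>x. w x * K powr S)" using w by auto
  show "(\<lambda>x. w x * K powr s x) \<in> borel_measurable M" by measurable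
  show "AE x in M. norm (w x * K powr s x) \<le> norm (w x * K powr S)"
    using s
  proof eventually_elim
    case (elim x)
    then show ?case
      using K by (auto simp: abs_mult intro!: mult_left_mono powr_mono)
  qed
qed

text \<open>Where \<open>s < S\<close> the integrand \<open>w * K powr (s - S)\<close> tends to \<open>0\<close>, where \<open>s = S\<close> it is
  constant; \<open>\<bar>w\<bar>\<close> dominates it for \<open>K \<ge> 1\<close>.\<close>

lemma tendsto_powr_integral_at_top:
  fixes w s :: "'a \<Rightarrow> real"
  assumes w: "integrable M w" and [measurable]: "s \<in> borel_measurable M"
    and s: "AE x in M. s x \<le> S"
  shows "((\<lambda>K. K powr - S * (LINT x|M. w x * K powr s x)) \<longlongrightarrow>
           (LINT x|M. indicator {x. s x = S} x * w x)) at_top"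
proof -
  have [measurable]: "w \<in> borel_measurable M" using w by auto
  have "((\<lambda>K. LINT x|M. w x * K powr (s x - S)) \<longlongrightarrow>
           (LINT x|M. indicator {x. s x = S} x * w x)) at_top"
  proof (rule integral_dominated_convergence_at_top[where w = "\<lambda>x. norm (w x)"])
    show "integrable M (\<lambda>x. norm (w x))" using w by auto
    show "\<forall>\<^sub>F K in at_top. AE x in M. norm (w x * K powr (s x - S)) \<le> norm (w x)"
      using eventually_ge_at_top[of 1]
    proof eventually_elim
      case (elim K)
      show ?case using s
      proof eventually_elim
        case (elim x)
        have "K powr (s x - S) \<le> K powr 0"
          using elim \<open>1 \<le> K\<close> by (intro powr_mono) auto
        then have "K powr (s x - S) \<le> 1" using \<open>1 \<le> K\<close> by simp
        then have "norm (w x) * K powr (s x - S) \<le> norm (w x) * 1"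
          by (intro mult_left_mono) auto
        then show ?case by (simp add: abs_mult)
      qed
    qed
    show "AE x in M. ((\<lambda>K. w x * K powr (s x - S)) \<longlongrightarrow> indicator {x. s x = S} x * w x) at_top"
      using s
    proof eventually_elim
      case (elim x)
      show ?case
      proof (cases "s x = S")
        case True
        have "\<forall>\<^sub>F K in at_top. w x * K powr (s x - S) = indicator {x. s x = S} x * w x"
          using eventually_gt_at_top[of 0] by eventually_elim (simp add: True)
        then show ?thesis by (rule tendsto_eventually)
      next
        case False
        with elim have "s x - S < 0" by simp
        then have "((\<lambda>K::real. K powr (s x - S)) \<longlongrightarrow> 0) at_top"
          by (intro tendsto_neg_powr) (auto simp: filterlim_ident)
        from tendsto_mult[OF tendsto_const[of "w x"] this] False show ?thesis by simp
      qed
    qed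
  qed (measurable)
  moreover have "\<forall>\<^sub>F K in at_top. (LINT x|M. w x * K powr (s x - S))
      = K powr - S * (LINT x|M. w x * K powr s x)"
    using eventually_gt_at_top[of 0]
  proof eventually_elim
    case (elim K)
    have "(LINT x|M. w x * K powr (s x - S)) = (LINT x|M. K powr - S * (w x * K powr s x))"
      by (intro Bochner_Integration.integral_cong) (auto simp: powr_diff powr_minus field_simps)
    then show ?case by simp
  qed
  ultimately show ?thesis by (rule Lim_transform_eventually)
qed

text \<open>If \<open>S1 < c < S2\<close>, then the first integral is at most a multiple of \<open>K powr S1\<close>, whereas
  the second is at least a positive multiple of \<open>K powr c\<close>, because \<open>s2 > c\<close> on a set that is not
  null.\<close>

lemma ess_max_le_of_powr_integral_eq:
  fixes w1 s1 :: "'a \<Rightarrow> real" and w2 s2 :: "'b \<Rightarrow> real"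
  assumes w1: "integrable M1 w1" "AE x in M1. 0 < w1 x"
    and w2: "integrable M2 w2" "AE x in M2. 0 < w2 x"
    and m1 [measurable]: "s1 \<in> borel_measurable M1" and m2 [measurable]: "s2 \<in> borel_measurable M2"
    and S1: "ess_max M1 s1 S1" and S2: "ess_max M2 s2 S2"
    and eq: "\<And>K. 1 \<le> K \<Longrightarrow> (LINT x|M1. w1 x * K powr s1 x) = (LINT x|M2. w2 x * K powr s2 x)"
  shows "S2 \<le> S1"
proof (rule ccontr)
  assume "\<not> S2 \<le> S1"
  then obtain c where c: "S1 < c" "c < S2" using dense not_le by metis
  have [measurable]: "w2 \<in> borel_measurable M2" using w2 by auto
  define I where "I = (LINT x|M2. indicator {x. c < s2 x} x * w2 x)"
  define W where "W = (LINT x|M1. w1 x)"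
  have intI: "integrable M2 (\<lambda>x. indicator {x. c < s2 x} x * w2 x)"
    by (rule Bochner_Integration.integrable_bound[OF w2(1)]) (auto simp: indicator_def)
  have "0 \<le> I" unfolding I_def
    using w2(2) by (intro integral_nonneg_AE) (auto simp: indicator_def elim: eventually_mono)
  moreover have "I \<noteq> 0"
  proof
    assume "I = 0"
    then have "AE x in M2. indicator {x. c < s2 x} x * w2 x = 0"
      unfolding I_def using w2(2)
      by (subst (asm) integral_nonneg_eq_0_iff_AE[OF intI]) (auto simp: indicator_def elim: eventually_mono)
    with w2(2) have "AE x in M2. s2 x \<le> c"
      by eventually_elim (auto simp: indicator_def split: if_splits)
    with S2 c show False by (auto simp: ess_max_def)
  qed
  ultimately have I: "0 < I" by simp
  have W: "0 \<le> W" unfolding W_def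
    using w1(2) by (intro integral_nonneg_AE) (auto elim: eventually_mono)
  \<comment> \<open>chosen so that the quotient \<open>K powr (c - S1)\<close> of the two growth rates exceeds \<open>W / I\<close>\<close>
  define K where "K = (1 + W / I) powr (1 / (c - S1))"
  have K: "1 \<le> K" unfolding K_def using I W c by (intro ge_one_powr_ge_zero) auto
  have "K powr (c - S1) = 1 + W / I"
    unfolding K_def using c I W by (simp add: powr_powr add_nonneg_eq_0_iff)
  then have KW: "K powr (c - S1) * I = I + W" using I by (simp add: field_simps)
  have "K powr c * I = (LINT x|M2. K powr c * (indicator {x. c < s2 x} x * w2 x))"
    by (simp add: I_def)
  also have "\<dots> \<le> (LINT x|M2. w2 x * K powr s2 x)"
  proof (rule integral_mono_AE)
    show "integrable M2 (\<lambda>x. K powr c * (indicator {x. c < s2 x} x * w2 x))" using intI by auto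
    show "integrable M2 (\<lambda>x. w2 x * K powr s2 x)"
      using integrable_powr_upper[OF w2(1) m2 _ K] S2 by (auto simp: ess_max_def)
    show "AE x in M2. K powr c * (indicator {x. c < s2 x} x * w2 x) \<le> w2 x * K powr s2 x"
      using w2(2)
    proof eventually_elim
      case (elim x)
      then show ?case using K
        by (auto simp: indicator_def mult.commute[of "w2 x"] intro!: mult_right_mono powr_mono)
    qed
  qed
  also have "\<dots> = (LINT x|M1. w1 x * K powr s1 x)" using eq[OF K] by simp
  also have "\<dots> \<le> (LINT x|M1. w1 x * K powr S1)"
  proof (rule integral_mono_AE)
    show "integrable M1 (\<lambda>x. w1 x * K powr S1)" using w1 by auto
    show "integrable M1 (\<lambda>x. w1 x * K powr s1 x)"
      using integrable_powr_upper[OF w1(1) m1 _ K] S1 by (auto simp: ess_max_def)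
    have "AE x in M1. s1 x \<le> S1" using S1 by (auto simp: ess_max_def)
    then show "AE x in M1. w1 x * K powr s1 x \<le> w1 x * K powr S1"
      using w1(2)
      by eventually_elim (use K in \<open>auto intro!: mult_left_mono powr_mono\<close>)
  qed
  also have "\<dots> = K powr S1 * W" by (simp add: W_def)
  finally have "K powr c * I \<le> K powr S1 * W" .
  moreover have "K powr c = K powr S1 * K powr (c - S1)"
    by (simp flip: powr_add)
  ultimately have "K powr S1 * (I + W) \<le> K powr S1 * W"
    using KW by (simp add: mult.assoc)
  then show False using K I by (simp add: mult_le_cancel_left)
qed

lemma powr_integral_determines_ess_max:
  fixes w1 s1 :: "'a \<Rightarrow> real" and w2 s2 :: "'b \<Rightarrow> real"
  assumes w1: "integrable M1 w1" "AE x in M1. 0 < w1 x"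
    and w2: "integrable M2 w2" "AE x in M2. 0 < w2 x"
    and m1: "s1 \<in> borel_measurable M1" and m2: "s2 \<in> borel_measurable M2"
    and S1: "ess_max M1 s1 S1" and S2: "ess_max M2 s2 S2"
    and eq: "\<And>K. 1 \<le> K \<Longrightarrow> (LINT x|M1. w1 x * K powr s1 x) = (LINT x|M2. w2 x * K powr s2 x)"
  shows "S1 = S2"
    and "(LINT x|M1. indicator {x. s1 x = S1} x * w1 x) = (LINT x|M2. indicator {x. s2 x = S2} x * w2 x)"
proof -
  show S: "S1 = S2"
    using ess_max_le_of_powr_integral_eq[OF w1 w2 m1 m2 S1 S2 eq]
      ess_max_le_of_powr_integral_eq[OF w2 w1 m2 m1 S2 S1 eq[symmetric]] by auto
  have "((\<lambda>K. K powr - S1 * (LINT x|M1. w1 x * K powr s1 x)) \<longlongrightarrow>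
           (LINT x|M1. indicator {x. s1 x = S1} x * w1 x)) at_top"
    by (rule tendsto_powr_integral_at_top[OF w1(1) m1]) (use S1 in \<open>simp add: ess_max_def\<close>)
  moreover have "\<forall>\<^sub>F K in at_top. K powr - S1 * (LINT x|M1. w1 x * K powr s1 x)
      = K powr - S2 * (LINT x|M2. w2 x * K powr s2 x)"
    using eventually_ge_at_top[of 1] by eventually_elim (simp add: eq S)
  ultimately have "((\<lambda>K. K powr - S2 * (LINT x|M2. w2 x * K powr s2 x)) \<longlongrightarrow>
           (LINT x|M1. indicator {x. s1 x = S1} x * w1 x)) at_top"
    by (rule Lim_transform_eventually)
  moreover have "((\<lambda>K. K powr - S2 * (LINT x|M2. w2 x * K powr s2 x)) \<longlongrightarrow>
           (LINT x|M2. indicator {x. s2 x = S2} x * w2 x)) at_top"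
    by (rule tendsto_powr_integral_at_top[OF w2(1) m2]) (use S2 in \<open>simp add: ess_max_def\<close>)
  ultimately show "(LINT x|M1. indicator {x. s1 x = S1} x * w1 x) = (LINT x|M2. indicator {x. s2 x = S2} x * w2 x)"
    using tendsto_unique trivial_limit_at_top_linorder by blast
qed

section \<open>The integral as a bijection of the positive reals\<close>

text \<open>An almost everywhere positive integrable weight \<open>w\<close> and an exponent \<open>s\<close> that is
  almost everywhere between two positive constants,
  on a finite measure space that is not null.\<close>

locale powr_integral = finite_measure M for M :: "'a measure" +
  fixes w s :: "'a \<Rightarrow> real" and lo hi :: real
  assumes nonnull: "emeasure M (space M) \<noteq> 0"
    and int_w: "integrable M w" and w_pos: "AE x in M. 0 < w x"
    and s_meas [measurable]: "s \<in> borel_measurable M"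
    and lo_pos: "0 < lo" and s_bounds: "AE x in M. lo \<le> s x \<and> s x \<le> hi"
begin

text \<open>The datum \<open>m\<close> as a function of the constant \<open>K = K_m\<close>.\<close>

definition F :: "real \<Rightarrow> real" where
  "F K = (LINT x|M. w x * K powr s x)"

lemma w_meas [measurable]: "w \<in> borel_measurable M"
  using int_w by auto

lemma powr_s_le:
  assumes "0 < K" "K \<le> d" "lo \<le> s x" "s x \<le> hi"
  shows "K powr s x \<le> (1 + d) powr hi"
proof -
  have "K powr s x \<le> (1 + d) powr s x" using assms lo_pos by (intro powr_mono2) auto
  also have "\<dots> \<le> (1 + d) powr hi" using assms by (intro powr_mono) auto
  finally show ?thesis .
qed

lemma norm_integrand_le:
  assumes "0 < K" "K \<le> d"
  shows "AE x in M. norm (w x * K powr s x) \<le> norm (w x * (1 + d) powr hi)"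
  using s_bounds by eventually_elim (auto simp: abs_mult powr_s_le assms intro!: mult_left_mono)

lemma integrable_F: "0 < K \<Longrightarrow> integrable M (\<lambda>x. w x * K powr s x)"
  by (rule Bochner_Integration.integrable_bound[OF _ _ norm_integrand_le[of K K]]) (use int_w in auto)

lemma F_strict_mono:
  assumes "0 < K" "K < L"
  shows "F K < F L"
  unfolding F_def
proof (rule integral_less_AE_space[OF integrable_F integrable_F _ nonnull])
  show "AE x in M. w x * K powr s x < w x * L powr s x"
    using w_pos s_bounds
    by eventually_elim (use assms lo_pos in \<open>auto intro!: mult_strict_left_mono powr_less_mono2\<close>)
qed (use assms in auto)

lemma F_pos: assumes "0 < K" shows "0 < F K"
proof -
  have "(LINT x|M. 0) < F K" unfolding F_def
  proof (rule integral_less_AE_space[OF _ integrable_F[OF assms] _ nonnull])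
    show "AE x in M. 0 < w x * K powr s x"
      using w_pos by eventually_elim (use assms in auto)
  qed auto
  then show ?thesis by simp
qed

lemma continuous_on_F: "continuous_on {0<..} F"
proof (rule continuous_on_sequentiallyI)
  fix u :: "nat \<Rightarrow> real" and K
  assume u: "\<forall>n. u n \<in> {0<..}" and K: "K \<in> {0<..}" and lim: "u \<longlonglongrightarrow> K"
  then have "Bseq u" using convergent_imp_Bseq convergentI by blast
  then obtain d where d: "\<And>n. norm (u n) \<le> d" by (auto simp: Bseq_def)
  show "(\<lambda>n. F (u n)) \<longlonglongrightarrow> F K"
    unfolding F_def
  proof (rule integral_dominated_convergence[where w = "\<lambda>x. norm (w x * (1 + d) powr hi)"])
    show "integrable M (\<lambda>x. norm (w x * (1 + d) powr hi))"
      using int_w by auto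
    show "AE x in M. (\<lambda>n. w x * u n powr s x) \<longlonglongrightarrow> w x * K powr s x"
      using K lim by (intro AE_I2 tendsto_intros) auto
    show "AE x in M. norm (w x * u n powr s x) \<le> norm (w x * (1 + d) powr hi)" for n
      using norm_integrand_le[of "u n" d] u d[of n] by auto
  qed measurable
qed

text \<open>The next two estimates, with the lower bound of \<open>s\<close>, show that \<open>F\<close> is unbounded and tends
  to \<open>0\<close> at \<open>0\<close>.\<close>

lemma F_ge: assumes "1 \<le> K" shows "K powr lo * F 1 \<le> F K"
proof -
  have "K powr lo * F 1 = (LINT x|M. w x * K powr lo)"
    by (simp add: F_def)
  also have "\<dots> \<le> F K" unfolding F_def
  proof (rule integral_mono_AE)
    show "AE x in M. w x * K powr lo \<le> w x * K powr s x"
      using w_pos s_bounds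
      by eventually_elim (use assms in \<open>auto intro!: mult_left_mono powr_mono\<close>)
  qed (use int_w integrable_F assms in auto)
  finally show ?thesis .
qed

lemma F_le: assumes "0 < K" "K \<le> 1" shows "F K \<le> K powr lo * F 1"
proof -
  have "F K \<le> (LINT x|M. w x * K powr lo)" unfolding F_def
  proof (rule integral_mono_AE)
    show "AE x in M. w x * K powr s x \<le> w x * K powr lo"
      using w_pos s_bounds
      by eventually_elim (use assms in \<open>auto intro!: mult_left_mono powr_mono'\<close>)
  qed (use int_w integrable_F assms in auto)
  also have "\<dots> = K powr lo * F 1"
    by (simp add: F_def)
  finally show ?thesis .
qed

lemma F_surj:
  assumes m: "0 < m"
  obtains K where "0 < K" "F K = m"
proof -
  have F1: "0 < F 1" by (simp add: F_pos)
  \<comment> \<open>the solution when \<open>s\<close> is constantly \<open>lo\<close>; in general \<open>m\<close> lies between \<open>F 1\<close> and \<open>F L\<close>\<close>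
  define L where "L = (m / F 1) powr (1 / lo)"
  have L0: "0 < L" using m F1 by (simp add: L_def)
  have "L powr lo = m / F 1" using m F1 lo_pos by (simp add: L_def powr_powr)
  then have L: "L powr lo * F 1 = m" using F1 by simp
  have cont: "continuous_on {x..y} F" if "0 < x" for x y
    by (rule continuous_on_subset[OF continuous_on_F]) (use that in auto)
  consider "1 \<le> L" | "L \<le> 1" by linarith
  then show thesis
  proof cases
    case 1
    have "F 1 \<le> m"
      using ge_one_powr_ge_zero[OF 1, of lo] lo_pos F1 by (subst L[symmetric]) auto
    moreover have "m \<le> F L" using F_ge[OF 1] L by simp
    ultimately obtain K where "1 \<le> K" "F K = m"
      using IVT'[of F 1 m L] cont[of 1 L] 1 by auto
    then show ?thesis using that[of K] by simp
  next
    case 2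
    have "m \<le> F 1"
      using powr_le1[of lo L] lo_pos F1 2 L0 by (subst L[symmetric]) (auto simp: mult_left_le_one_le)
    moreover have "F L \<le> m" using F_le[OF L0 2] L by simp
    ultimately obtain K where "L \<le> K" "F K = m"
      using IVT'[of F L m 1] cont[of L 1] L0 2 by auto
    then show ?thesis using that[of K] L0 by simp
  qed
qed

lemma F_inj: "0 < K \<Longrightarrow> 0 < L \<Longrightarrow> F K = F L \<Longrightarrow> K = L"
  by (metis F_strict_mono less_irrefl linorder_neqE_linordered_idom)

lemma F_root: "0 < K \<Longrightarrow> (THE L. 0 < L \<and> F K = F L) = K"
  using F_inj by blast

end


section \<open>Essential bounds of the exponent\<close>

lemma ess_max_esssup:
  assumes [measurable]: "f \<in> borel_measurable M" and nonnull: "emeasure M (space M) \<noteq> 0"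
    and bounds: "AE x in M. L \<le> f x \<and> f x \<le> U"
  shows "ess_max M f (real_of_ereal (esssup M (\<lambda>x. ereal (f x))))"
proof -
  let ?E = "esssup M (\<lambda>x. ereal (f x))"
  have le: "AE x in M. ereal (f x) \<le> ?E" by (rule esssup_AE)
  have E_le: "?E \<le> ereal c" if "AE x in M. f x \<le> c" for c
    by (rule esssup_I) (use that in auto)
  have "?E \<le> ereal U" using bounds by (intro E_le) (auto elim: eventually_mono)
  moreover have "ereal L \<le> ?E"
  proof (rule ccontr)
    assume "\<not> ereal L \<le> ?E"
    have "AE x in M. False"
      using le bounds
    proof eventually_elim
      case (elim x)
      then have "ereal L \<le> ereal (f x)" by simp
      with elim \<open>\<not> ereal L \<le> ?E\<close> show False using order.trans by blast
    qed
    with nonnull show False by (simp add: eventually_False ae_filter_eq_bot_iff)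
  qed
  ultimately have fin: "?E = ereal (real_of_ereal ?E)"
    by (cases ?E) auto
  show ?thesis
    unfolding ess_max_def
  proof (intro conjI allI impI)
    show "AE x in M. f x \<le> real_of_ereal ?E"
      using le by (subst (asm) fin) simp
    fix c assume "AE x in M. f x \<le> c"
    from E_le[OF this] show "real_of_ereal ?E \<le> c" by (subst (asm) fin) simp
  qed
qed

lemma essinf_eq_uminus_esssup:
  assumes [measurable]: "f \<in> borel_measurable M"
  shows "essinf M f = - esssup M (\<lambda>x. - f x)"
proof -
  have "esssup M (\<lambda>x. - f x) = Inf {z. AE x in M. - f x \<le> z}"
    by (rule esssup_eq_AE) measurable
  also have "{z. AE x in M. - f x \<le> z} = uminus ` {z. AE x in M. z \<le> f x}"
  proof (intro set_eqI iffI)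
    fix z assume "z \<in> {z. AE x in M. - f x \<le> z}"
    then have "- z \<in> {z. AE x in M. z \<le> f x}" by (simp add: ereal_uminus_le_reorder)
    then show "z \<in> uminus ` {z. AE x in M. z \<le> f x}" by (intro image_eqI[of _ _ "- z"]) auto
  qed auto
  also have "Inf \<dots> = - essinf M f"
    by (simp add: ereal_Inf_uminus_image_eq essinf_def)
  finally show ?thesis by simp
qed

lemma ess_max_essinf:
  assumes [measurable]: "f \<in> borel_measurable M" and nonnull: "emeasure M (space M) \<noteq> 0"
    and bounds: "AE x in M. L \<le> f x \<and> f x \<le> U"
  shows "ess_max M (\<lambda>x. - f x) (- real_of_ereal (essinf M (\<lambda>x. ereal (f x))))"
proof -
  have "AE x in M. - U \<le> - f x \<and> - f x \<le> - L"
    using bounds by eventually_elim auto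
  from ess_max_esssup[OF _ nonnull this] show ?thesis
    by (simp add: essinf_eq_uminus_esssup)
qed

lemma ess_max_ge:
  assumes "ess_max M f S" "emeasure M (space M) \<noteq> 0" "AE x in M. L \<le> f x"
  shows "L \<le> S"
proof (rule ccontr)
  assume "\<not> L \<le> S"
  have "AE x in M. f x \<le> S" using assms by (simp add: ess_max_def)
  with assms(3) have "AE x in M. False"
    by eventually_elim (use \<open>\<not> L \<le> S\<close> in auto)
  with assms(2) show False by (simp add: eventually_False ae_filter_eq_bot_iff)
qed

text \<open>The map \<open>p \<mapsto> 1 / (p - 1)\<close> is a decreasing bijection of the reals above \<open>1\<close> onto the positive
  reals, so it carries the essential infimum of \<open>p\<close> to the essential supremum of the image, and
  vice versa.  An essential bound \<open>c\<close> of the image has first to be compared with \<open>0\<close>, as only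
  positive bounds correspond to bounds of \<open>p\<close>.\<close>

lemma ess_max_gradient_exponent:
  assumes q: "ess_max M (\<lambda>x. - p x) (- q)" and nonnull: "emeasure M (space M) \<noteq> 0"
    and p: "AE x in M. 1 < p x" and "1 < q"
  shows "ess_max M (\<lambda>x. 1 / (p x - 1)) (1 / (q - 1))"
  unfolding ess_max_def
proof (intro conjI allI impI)
  have "AE x in M. - p x \<le> - q" using q by (simp add: ess_max_def)
  then show "AE x in M. 1 / (p x - 1) \<le> 1 / (q - 1)"
    by eventually_elim (use \<open>1 < q\<close> in \<open>auto intro!: divide_left_mono\<close>)
next
  fix c assume c: "AE x in M. 1 / (p x - 1) \<le> c"
  have "0 < c"
  proof (rule ccontr)
    assume "\<not> 0 < c"
    from c p have "AE x in M. False"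
    proof eventually_elim
      case (elim x)
      then have "0 < 1 / (p x - 1)" by simp
      with elim \<open>\<not> 0 < c\<close> show False by linarith
    qed
    with nonnull show False by (simp add: eventually_False ae_filter_eq_bot_iff)
  qed
  from c p have "AE x in M. - p x \<le> - (1 + 1 / c)"
    by eventually_elim (use \<open>0 < c\<close> in \<open>simp add: field_simps\<close>)
  with q have "- q \<le> - (1 + 1 / c)" unfolding ess_max_def by blast
  then show "1 / (q - 1) \<le> c" using \<open>0 < c\<close> \<open>1 < q\<close> by (simp add: field_simps)
qed

lemma ess_max_neg_gradient_exponent:
  assumes q: "ess_max M p q" and p: "AE x in M. 1 < p x" and "1 < q"
  shows "ess_max M (\<lambda>x. - (1 / (p x - 1))) (- (1 / (q - 1)))"
  unfolding ess_max_def
proof (intro conjI allI impI)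
  have "AE x in M. p x \<le> q" using q by (simp add: ess_max_def)
  then show "AE x in M. - (1 / (p x - 1)) \<le> - (1 / (q - 1))"
    using p by eventually_elim (auto intro!: divide_left_mono)
next
  fix c assume c: "AE x in M. - (1 / (p x - 1)) \<le> c"
  show "- (1 / (q - 1)) \<le> c"
  proof (cases "c < 0")
    case False
    have "0 < 1 / (q - 1)" using \<open>1 < q\<close> by simp
    with False show ?thesis by linarith
  next
    case True
    from c p have "AE x in M. p x \<le> 1 - 1 / c"
      by eventually_elim (use True in \<open>simp add: field_simps\<close>)
    with q have "q \<le> 1 - 1 / c" unfolding ess_max_def by blast
    then show ?thesis using True \<open>1 < q\<close> by (simp add: field_simps)
  qed
qed

section \<open>The DN map\<close>

text \<open>The integrand in the equation defining \<open>K_const\<close> is \<open>weight \<gamma> p x * K powr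
  gradient_exponent p x\<close>.\<close>

abbreviation weight :: "(real \<Rightarrow> real) \<Rightarrow> (real \<Rightarrow> real) \<Rightarrow> real \<Rightarrow> real" where
  "weight \<gamma> p \<equiv> \<lambda>x. \<gamma> x powr (- 1 / (p x - 1))"

abbreviation gradient_exponent :: "(real \<Rightarrow> real) \<Rightarrow> real \<Rightarrow> real" where
  "gradient_exponent p \<equiv> \<lambda>x. 1 / (p x - 1)"

lemma emeasure_lebesgue_on_interval_nonzero:
  fixes a b :: real
  assumes "a < b"
  shows "emeasure (lebesgue_on {a..b}) (space (lebesgue_on {a..b})) \<noteq> 0"
  using assms by (simp add: emeasure_restrict_space)

lemma powr_integral_weight:
  assumes "a < b" "Linf_plus a b \<gamma>" "admissible a b p"
  obtains lo hi where
    "powr_integral (lebesgue_on {a..b}) (weight \<gamma> p) (gradient_exponent p) lo hi"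
proof -
  let ?M = "lebesgue_on {a..b}"
  from assms obtain d where [measurable]: "\<gamma> \<in> borel_measurable ?M"
    and d: "0 < d" "AE x in ?M. d < \<gamma> x \<and> \<gamma> x < 1 / d" by (auto simp: Linf_plus_def)
  from assms obtain e where [measurable]: "p \<in> borel_measurable ?M"
    and e: "0 < e" "AE x in ?M. 1 + e < p x \<and> p x < 1 / e" by (auto simp: admissible_def)
  interpret finite_measure ?M
    by (intro finite_measureI) (simp add: emeasure_restrict_space emeasure_lborel_Icc_eq)
  have "powr_integral ?M (weight \<gamma> p) (gradient_exponent p) e (1 / e)"
  proof unfold_locales
    show "emeasure ?M (space ?M) \<noteq> 0"
      by (rule emeasure_lebesgue_on_interval_nonzero[OF \<open>a < b\<close>])
    show "integrable ?M (weight \<gamma> p)"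
    proof (rule integrable_const_bound)
      show "AE x in ?M. norm (weight \<gamma> p x) \<le> (1 + 1 / d) powr (1 / e)"
        using d(2) e(2)
      proof eventually_elim
        case (elim x)
        have "weight \<gamma> p x = (1 / \<gamma> x) powr (1 / (p x - 1))"
          using elim d by (simp add: powr_divide powr_minus_divide flip: minus_divide_left)
        also have "\<dots> \<le> (1 + 1 / d) powr (1 / (p x - 1))"
        proof (rule powr_mono2)
          have "1 / \<gamma> x \<le> 1 / d" using elim d by (intro divide_left_mono) auto
          then show "1 / \<gamma> x \<le> 1 + 1 / d" by simp
        qed (use elim d e in auto)
        also have "\<dots> \<le> (1 + 1 / d) powr (1 / e)"
          using elim d e by (intro powr_mono divide_left_mono) auto
        finally show ?case by simp
      qed
    qed measurable
    show "AE x in ?M. 0 < weight \<gamma> p x"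
      using d(2) by eventually_elim (use d in auto)
    show "AE x in ?M. e \<le> gradient_exponent p x \<and> gradient_exponent p x \<le> 1 / e"
      using e(2)
    proof eventually_elim
      case (elim x)
      have "e \<le> gradient_exponent p x"
      proof -
        have "p x - 1 \<le> 1 / e" using elim by simp
        then have "e * (p x - 1) \<le> 1" using e by (simp add: field_simps)
        then show ?thesis using elim e by (simp add: pos_le_divide_eq)
      qed
      moreover have "gradient_exponent p x \<le> 1 / e"
        using elim e by (intro divide_left_mono) auto
      ultimately show ?case by simp
    qed
  qed (use e in \<open>simp, measurable\<close>)
  then show thesis by (rule that)
qed

text \<open>Since \<open>p / (p - 1) = 1 + 1 / (p - 1)\<close>, the integral defining the DN map at \<open>m\<close> equals
  \<open>K_m * m\<close>; here \<open>m = F K\<close>, so that \<open>K_m = K\<close>.\<close>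

lemma DN_map_at_F:
  assumes "powr_integral (lebesgue_on {a..b}) (weight \<gamma> p) (gradient_exponent p) lo hi" and K: "0 < K"
  shows "DN_map a b \<gamma> p (powr_integral.F (lebesgue_on {a..b}) (weight \<gamma> p) (gradient_exponent p) K)
       = K * powr_integral.F (lebesgue_on {a..b}) (weight \<gamma> p) (gradient_exponent p) K"
proof -
  interpret powr_integral "lebesgue_on {a..b}" "weight \<gamma> p" "gradient_exponent p" lo hi by fact
  have "K_const a b \<gamma> p (F K) = K"
    using F_root[OF K, unfolded F_def] unfolding K_const_def F_def .
  then have "DN_map a b \<gamma> p (F K)
      = (LINT x|lebesgue_on {a..b}. weight \<gamma> p x * K powr (p x / (p x - 1)))"
    by (simp add: DN_map_def)
  also have "\<dots> = (LINT x|lebesgue_on {a..b}. K * (weight \<gamma> p x * K powr gradient_exponent p x))"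
  proof (rule integral_cong_AE)
    have "(\<lambda>x. p x / (p x - 1)) \<in> borel_measurable (lebesgue_on {a..b})"
    proof -
      have "(\<lambda>x. 1 / gradient_exponent p x) \<in> borel_measurable (lebesgue_on {a..b})" by measurable
      then have [measurable]: "(\<lambda>x. p x - 1) \<in> borel_measurable (lebesgue_on {a..b})" by simp
      have "(\<lambda>x. ((p x - 1) + 1) / (p x - 1)) \<in> borel_measurable (lebesgue_on {a..b})"
        by measurable
      then show ?thesis by simp
    qed
    then show "(\<lambda>x. weight \<gamma> p x * K powr (p x / (p x - 1))) \<in> borel_measurable (lebesgue_on {a..b})"
      by measurable
    show "AE x in lebesgue_on {a..b}. weight \<gamma> p x * K powr (p x / (p x - 1))
        = K * (weight \<gamma> p x * K powr gradient_exponent p x)"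
      using s_bounds
    proof eventually_elim
      case (elim x)
      then have "p x \<noteq> 1" using lo_pos by auto
      then have "p x / (p x - 1) = 1 + 1 / (p x - 1)" by (simp add: field_simps)
      then show ?case using K by (simp add: powr_add)
    qed
  qed measurable
  also have "\<dots> = K * F K" unfolding F_def by simp
  finally show ?thesis .
qed

text \<open>No assumption on the range of \<open>p\<close> is needed: \<open>p \<mapsto> 1 / (p - 1)\<close> is injective on all
  reals: as \<open>1 / 0 = 0\<close>, it takes the value \<open>0\<close> at \<open>p = 1\<close>, and only there.\<close>

lemma integral_level_set:
  assumes p: "p \<in> borel_measurable (lebesgue_on {a..b})"
  shows "(LINT x|lebesgue_on {x \<in> {a..b}. p x = q}. \<gamma> x powr (- 1 / (q - 1)))
    = (LINT x|lebesgue_on {a..b}. indicator {x. gradient_exponent p x = 1 / (q - 1)} x * weight \<gamma> p x)"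
proof -
  have [measurable]: "p \<in> borel_measurable (lebesgue_on {a..b})" by fact
  have iff: "gradient_exponent p x = 1 / (q - 1) \<longleftrightarrow> p x = q" for x
    by (metis diff_add_cancel inverse_eq_divide inverse_inverse_eq)
  let ?B = "{x \<in> {a..b}. p x = q}"
  have "{x \<in> space (lebesgue_on {a..b}). p x = q} \<in> sets (lebesgue_on {a..b})" by measurable
  then have meas: "?B \<in> sets (lebesgue_on {a..b})" by simp
  then have B: "?B \<in> sets lebesgue"
    by (subst (asm) sets_restrict_space_iff) simp_all
  have "{a..b} \<inter> ?B = ?B" by blast
  then have res: "restrict_space (lebesgue_on {a..b}) ?B = lebesgue_on ?B"
    using B by (subst restrict_restrict_space) simp_all
  have meas': "?B \<inter> space (lebesgue_on {a..b}) \<in> sets (lebesgue_on {a..b})"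
    using meas by (simp only: sets.Int_space_eq2)
  have "(LINT x|lebesgue_on ?B. \<gamma> x powr (- 1 / (q - 1)))
    = (LINT x|lebesgue_on {a..b}. indicator ?B x *\<^sub>R \<gamma> x powr (- 1 / (q - 1)))"
    using integral_restrict_space[OF meas'] unfolding res .
  also have "\<dots> = (LINT x|lebesgue_on {a..b}.
      indicator {x. gradient_exponent p x = 1 / (q - 1)} x * weight \<gamma> p x)"
    by (intro Bochner_Integration.integral_cong) (auto simp: iff indicator_def)
  finally show ?thesis .
qed

lemma p_plus_p_minus_ess_max:
  assumes "a < b" "admissible a b p"
  defines "M \<equiv> lebesgue_on {a..b}"
  shows "1 < p_minus a b p" "1 < p_plus a b p"
    "ess_max M (gradient_exponent p) (1 / (p_minus a b p - 1))"
    "ess_max M (\<lambda>x. - gradient_exponent p x) (- (1 / (p_plus a b p - 1)))"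
proof -
  from assms obtain e where [measurable]: "p \<in> borel_measurable M"
    and e: "0 < e" "AE x in M. 1 + e < p x \<and> p x < 1 / e" by (auto simp: admissible_def)
  have nonnull: "emeasure M (space M) \<noteq> 0"
    unfolding M_def by (rule emeasure_lebesgue_on_interval_nonzero[OF \<open>a < b\<close>])
  have p: "AE x in M. 1 + e \<le> p x \<and> p x \<le> 1 / e" using e(2) by eventually_elim auto
  have p1: "AE x in M. 1 < p x" using e(2) by eventually_elim (use e in auto)
  have plus: "ess_max M p (p_plus a b p)"
    unfolding p_plus_def M_def[symmetric] by (rule ess_max_esssup[OF _ nonnull p]) measurable
  have minus: "ess_max M (\<lambda>x. - p x) (- p_minus a b p)"
    unfolding p_minus_def M_def[symmetric] by (rule ess_max_essinf[OF _ nonnull p]) measurable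
  have "1 + e \<le> p_plus a b p"
    by (rule ess_max_ge[OF plus nonnull]) (use p in \<open>auto elim: eventually_mono\<close>)
  then show plus1: "1 < p_plus a b p" using e by simp
  have "AE x in M. - p x \<le> - (1 + e)" using p by eventually_elim auto
  then have "- p_minus a b p \<le> - (1 + e)" using minus unfolding ess_max_def by blast
  then show minus1: "1 < p_minus a b p" using e by simp
  show "ess_max M (gradient_exponent p) (1 / (p_minus a b p - 1))"
    by (rule ess_max_gradient_exponent[OF minus nonnull p1 minus1])
  show "ess_max M (\<lambda>x. - gradient_exponent p x) (- (1 / (p_plus a b p - 1)))"
    by (rule ess_max_neg_gradient_exponent[OF plus p1 plus1])
qed

section \<open>Determination of the extremal exponents\<close>

theorem theorem2:
  fixes a b :: real and \<gamma>1 \<gamma>2 p1 p2 :: "real \<Rightarrow> real"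
  assumes "a < b"
    and "Linf_plus a b \<gamma>1" and "Linf_plus a b \<gamma>2"
    and "admissible a b p1" and "admissible a b p2"
    and "\<forall>m>0. DN_map a b \<gamma>1 p1 m = DN_map a b \<gamma>2 p2 m"
  shows "p_plus a b p1 = p_plus a b p2 \<and>
    p_minus a b p1 = p_minus a b p2 \<and>
    (emeasure lebesgue {x \<in> {a..b}. p1 x = p_minus a b p1} > 0 \<and>
     emeasure lebesgue {x \<in> {a..b}. p2 x = p_minus a b p2} > 0 \<longrightarrow>
       (LINT x|lebesgue_on {x \<in> {a..b}. p1 x = p_minus a b p1}.
          \<gamma>1 x powr (- 1 / (p_minus a b p1 - 1))) =
       (LINT x|lebesgue_on {x \<in> {a..b}. p2 x = p_minus a b p2}.
          \<gamma>2 x powr (- 1 / (p_minus a b p2 - 1)))) \<and>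
    (emeasure lebesgue {x \<in> {a..b}. p1 x = p_plus a b p1} > 0 \<and>
     emeasure lebesgue {x \<in> {a..b}. p2 x = p_plus a b p2} > 0 \<longrightarrow>
       (LINT x|lebesgue_on {x \<in> {a..b}. p1 x = p_plus a b p1}.
          \<gamma>1 x powr (- 1 / (p_plus a b p1 - 1))) =
       (LINT x|lebesgue_on {x \<in> {a..b}. p2 x = p_plus a b p2}.
          \<gamma>2 x powr (- 1 / (p_plus a b p2 - 1))))"
proof -
  let ?M = "lebesgue_on {a..b}"
  obtain lo1 hi1 where L1: "powr_integral ?M (weight \<gamma>1 p1) (gradient_exponent p1) lo1 hi1"
    using powr_integral_weight assms by blast
  obtain lo2 hi2 where L2: "powr_integral ?M (weight \<gamma>2 p2) (gradient_exponent p2) lo2 hi2"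
    using powr_integral_weight assms by blast
  interpret A: powr_integral ?M "weight \<gamma>1 p1" "gradient_exponent p1" lo1 hi1 by fact
  interpret B: powr_integral ?M "weight \<gamma>2 p2" "gradient_exponent p2" lo2 hi2 by fact
  have F_eq: "A.F K = B.F K" if K: "0 < K" for K
  proof -
    \<comment> \<open>both DN maps are evaluated at \<open>m = A.F K\<close>, where they are \<open>m * K\<close> and \<open>m * K'\<close>\<close>
    from A.F_pos[OF K] have m: "0 < A.F K" .
    then obtain K' where K': "0 < K'" "B.F K' = A.F K" using B.F_surj by blast
    have "K * A.F K = K' * B.F K'"
      using assms(6) m DN_map_at_F[OF L1 K] DN_map_at_F[OF L2 K'(1)] K'(2) by simp
    then show ?thesis using m K' by simp
  qed
  have eq_top: "(LINT x|?M. weight \<gamma>1 p1 x * K powr gradient_exponent p1 x)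
      = (LINT x|?M. weight \<gamma>2 p2 x * K powr gradient_exponent p2 x)" if "1 \<le> K" for K
    using F_eq[of K] that unfolding A.F_def B.F_def by simp
  have eq_bot: "(LINT x|?M. weight \<gamma>1 p1 x * K powr - gradient_exponent p1 x)
      = (LINT x|?M. weight \<gamma>2 p2 x * K powr - gradient_exponent p2 x)" if "1 \<le> K" for K
  proof -
    have inv: "(1 / K) powr t = K powr - t" for t
      using that by (simp add: powr_divide powr_minus_divide)
    have "A.F (1 / K) = B.F (1 / K)" using that by (intro F_eq) simp
    then show ?thesis unfolding A.F_def B.F_def inv .
  qed
  note E1 = p_plus_p_minus_ess_max[OF assms(1,4)] and E2 = p_plus_p_minus_ess_max[OF assms(1,5)]
  note top = powr_integral_determines_ess_max[OF A.int_w A.w_pos B.int_w B.w_pos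
      A.s_meas B.s_meas E1(3) E2(3) eq_top]
  note bot = powr_integral_determines_ess_max[OF A.int_w A.w_pos B.int_w B.w_pos
      borel_measurable_uminus[OF A.s_meas] borel_measurable_uminus[OF B.s_meas] E1(4) E2(4) eq_bot]
  have minus: "p_minus a b p1 = p_minus a b p2" using top(1) E1(1) E2(1) by simp
  have plus: "p_plus a b p1 = p_plus a b p2" using bot(1) E1(2) E2(2) by simp
  have p: "p1 \<in> borel_measurable ?M" "p2 \<in> borel_measurable ?M"
    using assms by (auto simp: admissible_def)
  show ?thesis
    unfolding integral_level_set[OF p(1)] integral_level_set[OF p(2)]
    using top(2) bot(2) minus plus by (simp only: neg_equal_iff_equal simp_thms)
qed

end
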